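(* Let $\Gamma$ and $\Delta$ be directed graphs, let $\mathbf{P}=P\Delta$ be the free category on $\Delta$, let $RelB$ be a set of pairs $(l,r)$ of parallel arrows of $\mathbf{P}$ (i.e. $l,r:B\to B'$ for some objects $B,B'$), and let $\mathbf{B}=\mathbf{P}/RelB$ be the quotient category (by the congruence generated by $RelB$), with $[p]$ denoting the class of an arrow $p$. Let $X$ assign to each object $A$ of $\Gamma$ a set $XA$ and to each arrow $a:A_1\to A_2$ of $\Gamma$ a function $XA_1\to XA_2$, $x\mapsto x\cdot a$; and let $F$ be a graph morphism from $\Gamma$ to the underlying graph of $\mathbf{P}$ (assigning an object $FA$ of $\Delta$ to each object $A$ and an arrow $F(a):FA_1\to FA_2$ of $\mathbf{P}$ to each arrow $a:A_1\to A_2$). Let $\mathbf{A}$ be a small category generated by the graph $\Gamma$, let $X'$ be an action of $\mathbf{A}$ with $X'A=XA$ for every object $A$ and $X'a=Xa$ for every arrow $a$ of $\Gamma$, and let $F':\mathbf{A}\to\mathbf{B}$ be a functor with $F'A=FA$ for every object and $F'(a)=[F(a)]$ for every arrow $a$ of $\Gamma$. Let $T=\bigsqcup_{B\in\mathrm{ob}\,\Delta}\bigsqcup_{A\in\mathrm{ob}\,\Gamma} XA\times\mathbf{P}(FA,B)$, with elements written $x|p$, with $\tau(x|p)=\mathrm{tgt}(p)$ and with partial right action $(x|p)\cdot q=x|pq$ whenever $\mathrm{src}(q)=\tau(x|p)$. Let $R=(R_\varepsilon,R_K)$ where $R_\varepsilon=\{(x|F(a),\ (x\cdot a)|\mathrm{id}_{FA_2})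 : a:A_1\to A_2 \text{ an arrow of }\Gamma,\ x\in XA_1\}$ and $R_K=RelB$, and let $\stackrel{*}{\leftrightarrow}_R$ be the reflexive, symmetric, transitive closure of the reduction relation $\to_R$ generated by $R$ on $T$; write $[t]$ for the class of $t\in T$. Then: (i) $t_1\stackrel{*}{\leftrightarrow}_R t_2$ implies $\tau(t_1)=\tau(t_2)$, so $\bar\tau[t]:=\tau(t)$ is well defined; (ii) for each object $B$ of $\mathbf{B}$ put $KB=\{[t]: \bar\tau[t]=B\}$, and for each arrow $b:B_1\to B_2$ of $\mathbf{B}$ put $Kb:KB_1\to KB_2$, $[t]\mapsto[t\cdot p]$ where $p$ is any arrow of $\mathbf{P}$ with $[p]=b$; this is well defined and makes $K$ an action of $\mathbf{B}$; (iii) with $\varepsilon_A:XA\to K(F'A)$, $x\mapsto [x|\mathrm{id}_{FA}]$ for each object $A$ of $\mathbf{A}$, the pair $(K,\varepsilon)$ is a Kan extension of the action $X'$ along $F'$.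
   Context: Free category: $P\Delta$ has the objects of $\Delta$, an identity $\mathrm{id}_B$ at each object, and as non-identity arrows $B\to B'$ the nonempty composable words $d_1\cdots d_n$ of arrows of $\Delta$ with $\mathrm{tgt}(d_i)=\mathrm{src}(d_{i+1})$, $\mathrm{src}(d_1)=B$, $\mathrm{tgt}(d_n)=B'$; composition is juxtaposition, and $pq$ means "first $p$, then $q$" (diagrammatic order throughout). An action of a category $\mathbf{C}$ assigns a set $KC$ to each object $C$ and to each arrow $c:C_1\to C_2$ a function $Kc:KC_1\to KC_2$, written $z\mapsto z\cdot c$, such that $z\cdot\mathrm{id}=z$ and $(z\cdot c_1)\cdot c_2=z\cdot(c_1c_2)$. The reduction relation $\to_R$ generated by $R=(R_T,R_P)$ (with $R_T\subseteq T\times T$, $R_P$ a set of pairs of parallel arrows of $\mathbf{P}$) is: $t_1\to_R t_2$ iff either there are $(s,u)\in R_T$ and an arrow $q$ with $t_1=s\cdot q$, $t_2=u\cdot q$, or there are $(l,r)\in R_P$, $s\in T$ and an arrow $q$ (identities allowed) with $t_1=s\cdot(lq)$, $t_2=s\cdot(rq)$. Given an action $X'$ of $\mathbf{A}$ and a functor $F':\mathbf{A}\to\mathbf{B}$, an extension of $X'$ along $F'$ is a pair $(K,\varepsilon)$ with $K$ an action of $\mathbf{B}$ and $\varepsilon$ a family of functions $\varepsilon_A:X'A\to K(F'A)$ natural in the sense $\varepsilon_{A_2}(x\cdot a)=\varepsilon_{A_1}(x)\cdot F'(a)$ for all $a:A_1\to A_2$. It is a Kan extension if for every extension $(K',\varepsilon')$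 there is a unique natural transformation $\alpha:K\to K'$ (functions $\alpha_B:KB\to K'B$ with $\alpha_{B_2}(z\cdot b)=\alpha_{B_1}(z)\cdot b$) such that $\varepsilon'_A=\alpha_{F'A}\circ\varepsilon_A$ for all $A$. *)

theory Defs
  imports "HOL-Library.FuncSet" "Graph_Theory.Arc_Walk"
begin

section \<open>Graph morphisms, categories and functors\<close>

record ('a, 'e, 'b, 'f) mor =
  on_obj :: "'a \<Rightarrow> 'b"
  on_arr :: "'e \<Rightarrow> 'f"

definition graph_morphism ::
  "('a, 'e) pre_digraph \<Rightarrow> ('b, 'f) pre_digraph \<Rightarrow> ('a, 'e, 'b, 'f) mor \<Rightarrow> bool" where
  "graph_morphism G H f \<longleftrightarrow>
     (\<forall>v\<in>verts G. on_obj f v \<in> verts H) \<and>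
     (\<forall>e\<in>arcs G. on_arr f e \<in> arcs H \<and>
        tail H (on_arr f e) = on_obj f (tail G e) \<and>
        head H (on_arr f e) = on_obj f (head G e))"

text \<open>Composition is in diagrammatic order throughout:
  \<open>cat_comp C p q\<close> means first \<open>p\<close>, then \<open>q\<close>. Its value is irrelevant unless
  \<open>tgt C p = src C q\<close>.\<close>

record ('o, 'a) cat =
  ugraph :: "('o, 'a) pre_digraph"
  cat_id :: "'o \<Rightarrow> 'a"
  cat_comp :: "'a \<Rightarrow> 'a \<Rightarrow> 'a"

abbreviation obj :: "('o, 'a) cat \<Rightarrow> 'o set" where "obj C \<equiv> verts (ugraph C)"
abbreviation arr :: "('o, 'a) cat \<Rightarrow> 'a set" where "arr C \<equiv> arcs (ugraph C)"
abbreviation src :: "('o, 'a) cat \<Rightarrow> 'a \<Rightarrow> 'o" where "src C \<equiv> tail (ugraph C)"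
abbreviation tgt :: "('o, 'a) cat \<Rightarrow> 'a \<Rightarrow> 'o" where "tgt C \<equiv> head (ugraph C)"

definition category :: "('o, 'a) cat \<Rightarrow> bool" where
  "category C \<longleftrightarrow>
     wf_digraph (ugraph C) \<and>
     (\<forall>B\<in>obj C. cat_id C B \<in> arr C \<and> src C (cat_id C B) = B \<and> tgt C (cat_id C B) = B) \<and>
     (\<forall>p\<in>arr C. \<forall>q\<in>arr C. tgt C p = src C q \<longrightarrow>
        cat_comp C p q \<in> arr C \<and>
        src C (cat_comp C p q) = src C p \<and> tgt C (cat_comp C p q) = tgt C q) \<and>
     (\<forall>p\<in>arr C. cat_comp C (cat_id C (src C p)) p = p \<and>
        cat_comp C p (cat_id C (tgt C p)) = p) \<and>
     (\<forall>p\<in>arr C. \<forall>q\<in>arr C. \<forall>r\<in>arr C. tgt C p = src C q \<longrightarrow> tgt C q = src C r \<longrightarrow>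
        cat_comp C (cat_comp C p q) r = cat_comp C p (cat_comp C q r))"

definition is_functor ::
  "('o1, 'a1) cat \<Rightarrow> ('o2, 'a2) cat \<Rightarrow> ('o1, 'a1, 'o2, 'a2) mor \<Rightarrow> bool" where
  "is_functor C D f \<longleftrightarrow>
     graph_morphism (ugraph C) (ugraph D) f \<and>
     (\<forall>B\<in>obj C. on_arr f (cat_id C B) = cat_id D (on_obj f B)) \<and>
     (\<forall>p\<in>arr C. \<forall>q\<in>arr C. tgt C p = src C q \<longrightarrow>
        on_arr f (cat_comp C p q) = cat_comp D (on_arr f p) (on_arr f q))"

inductive_set generated_arrows :: "('o, 'a) cat \<Rightarrow> 'a set \<Rightarrow> 'a set"
  for C :: "('o, 'a) cat" and S :: "'a set" where
  ident: "B \<in> obj C \<Longrightarrow> cat_id C B \<in> generated_arrows C S"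
| gen: "a \<in> S \<Longrightarrow> a \<in> generated_arrows C S"
| comp: "p \<in> generated_arrows C S \<Longrightarrow> q \<in> generated_arrows C S \<Longrightarrow> tgt C p = src C q \<Longrightarrow>
    cat_comp C p q \<in> generated_arrows C S"

text \<open>The category \<open>C\<close> is generated by the graph \<open>G\<close>: they have the same objects, and the arrows
  of \<open>G\<close>, interpreted in \<open>C\<close> by \<open>\<iota>\<close>, generate all arrows of \<open>C\<close>. The map \<open>\<iota>\<close> need not be injective.\<close>

definition generated_by ::
  "('o, 'a) cat \<Rightarrow> ('o, 'e) pre_digraph \<Rightarrow> ('e \<Rightarrow> 'a) \<Rightarrow> bool" where
  "generated_by C G \<iota> \<longleftrightarrow>
     obj C = verts G \<and>
     graph_morphism G (ugraph C) \<lparr>on_obj = (\<lambda>v. v), on_arr = \<iota>\<rparr> \<and>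
     arr C = generated_arrows C (\<iota> ` arcs G)"

section \<open>Free categories and quotient categories\<close>

text \<open>An arrow of the free category is a triple (source, word of arcs, target); the empty
  words are the identities.\<close>

type_synonym ('v, 'e) path = "'v \<times> 'e list \<times> 'v"

definition free_category :: "('v, 'e) pre_digraph \<Rightarrow> ('v, ('v, 'e) path) cat" where
  "free_category G =
     \<lparr>ugraph = \<lparr>verts = verts G, arcs = {(u, p, v). pre_digraph.awalk G u p v},
        tail = (\<lambda>(u, p, v). u), head = (\<lambda>(u, p, v). v)\<rparr>,
      cat_id = (\<lambda>u. (u, [], u)),
      cat_comp = (\<lambda>(u, p, v) (u', q, v'). (u, p @ q, v'))\<rparr>"

definition parallel_pairs :: "('o, 'a) cat \<Rightarrow> ('a \<times> 'a) set" where
  "parallel_pairs C = {(l, r). l \<in> arr C \<and> r \<in> arr C \<and> src C l = src C r \<and> tgt C l = tgt C r}"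

inductive_set congruence :: "('o, 'a) cat \<Rightarrow> ('a \<times> 'a) set \<Rightarrow> ('a \<times> 'a) set"
  for C :: "('o, 'a) cat" and Rel :: "('a \<times> 'a) set" where
  base: "(l, r) \<in> Rel \<Longrightarrow> (l, r) \<in> congruence C Rel"
| refl: "p \<in> arr C \<Longrightarrow> (p, p) \<in> congruence C Rel"
| sym: "(p, q) \<in> congruence C Rel \<Longrightarrow> (q, p) \<in> congruence C Rel"
| trans: "(p, q) \<in> congruence C Rel \<Longrightarrow> (q, r) \<in> congruence C Rel \<Longrightarrow> (p, r) \<in> congruence C Rel"
| comp: "(p, p') \<in> congruence C Rel \<Longrightarrow> (q, q') \<in> congruence C Rel \<Longrightarrow> tgt C p = src C q \<Longrightarrow>
    (cat_comp C p q, cat_comp C p' q') \<in> congruence C Rel"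

definition arrow_class :: "('o, 'a) cat \<Rightarrow> ('a \<times> 'a) set \<Rightarrow> 'a \<Rightarrow> 'a set" where
  "arrow_class C Rel p = congruence C Rel `` {p}"

text \<open>For \<open>Rel \<subseteq> parallel_pairs C\<close>, sources, targets and composites do not depend on the chosen
  representatives, so that \<open>the_elem\<close> and the unions below return the common value
  (lemma \<open>quotient_category_simps\<close>).\<close>

definition quotient_category :: "('o, 'a) cat \<Rightarrow> ('a \<times> 'a) set \<Rightarrow> ('o, 'a set) cat" where
  "quotient_category C Rel =
     \<lparr>ugraph = \<lparr>verts = obj C, arcs = arr C // congruence C Rel,
        tail = (\<lambda>c. the_elem (src C ` c)), head = (\<lambda>c. the_elem (tgt C ` c))\<rparr>,
      cat_id = (\<lambda>B. arrow_class C Rel (cat_id C B)),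
      cat_comp = (\<lambda>c d. \<Union>p\<in>c. \<Union>q\<in>d. arrow_class C Rel (cat_comp C p q))\<rparr>"

lemma category_free_category:
  assumes "wf_digraph G"
  shows "category (free_category G)"
proof -
  interpret wf_digraph G by fact
  show ?thesis
    unfolding category_def wf_digraph_def free_category_def
    by (auto simp: awalk_Nil_iff intro: awalk_hd_in_verts awalk_last_in_verts)
qed

lemma congruence_parallel:
  assumes "category C" "Rel \<subseteq> parallel_pairs C" "(p, q) \<in> congruence C Rel"
  shows "(p, q) \<in> parallel_pairs C"
  using assms(3)
proof induction
  case (comp p p' q q')
  then show ?case using assms(1) by (auto simp: category_def parallel_pairs_def)
qed (use assms(2) in \<open>auto simp: parallel_pairs_def\<close>)

lemma equiv_congruence:
  assumes "category C" "Rel \<subseteq> parallel_pairs C"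
  shows "equiv (arr C) (congruence C Rel)"
proof (intro equivI)
  show "congruence C Rel \<subseteq> arr C \<times> arr C"
    using congruence_parallel[OF assms] by (auto simp: parallel_pairs_def)
  show "refl_on (arr C) (congruence C Rel)"
    by (intro refl_onI congruence.refl)
  show "Relation.sym (congruence C Rel)"
    by (rule symI) (rule congruence.sym)
  show "Relation.trans (congruence C Rel)"
    by (rule transI) (rule congruence.trans)
qed

lemma quotient_category_simps:
  assumes "category C" "Rel \<subseteq> parallel_pairs C"
  shows "obj (quotient_category C Rel) = obj C"
    and "arr (quotient_category C Rel) = arrow_class C Rel ` arr C"
    and "p \<in> arr C \<Longrightarrow> src (quotient_category C Rel) (arrow_class C Rel p) = src C p"
    and "p \<in> arr C \<Longrightarrow> tgt (quotient_category C Rel) (arrow_class C Rel p) = tgt C p"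
    and "cat_id (quotient_category C Rel) B = arrow_class C Rel (cat_id C B)"
    and "p \<in> arr C \<Longrightarrow> q \<in> arr C \<Longrightarrow> tgt C p = src C q \<Longrightarrow>
      cat_comp (quotient_category C Rel) (arrow_class C Rel p) (arrow_class C Rel q) =
      arrow_class C Rel (cat_comp C p q)"
proof -
  note par = congruence_parallel[OF assms] and eqv = equiv_congruence[OF assms]
  show "obj (quotient_category C Rel) = obj C"
    by (simp add: quotient_category_def)
  show "arr (quotient_category C Rel) = arrow_class C Rel ` arr C"
    by (auto simp: quotient_category_def quotient_def arrow_class_def)
  show "cat_id (quotient_category C Rel) B = arrow_class C Rel (cat_id C B)"
    by (simp add: quotient_category_def)
  have self: "p \<in> arrow_class C Rel p" if "p \<in> arr C" for p
    using congruence.refl[OF that] by (simp add: arrow_class_def)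
  have ends: "src C p' = src C p" "tgt C p' = tgt C p" if "p' \<in> arrow_class C Rel p" for p p'
    using par[of p p'] that by (simp_all add: arrow_class_def parallel_pairs_def)
  show "src (quotient_category C Rel) (arrow_class C Rel p) = src C p" if "p \<in> arr C"
  proof -
    have "src C ` arrow_class C Rel p = (\<lambda>_. src C p) ` arrow_class C Rel p"
      by (rule image_cong[OF HOL.refl ends(1)])
    also have "\<dots> = {src C p}" using self[OF that] by (rule image_constant)
    finally show ?thesis by (simp add: quotient_category_def)
  qed
  show "tgt (quotient_category C Rel) (arrow_class C Rel p) = tgt C p" if "p \<in> arr C"
  proof -
    have "tgt C ` arrow_class C Rel p = (\<lambda>_. tgt C p) ` arrow_class C Rel p"
      by (rule image_cong[OF HOL.refl ends(2)])
    also have "\<dots> = {tgt C p}" using self[OF that] by (rule image_constant)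
    finally show ?thesis by (simp add: quotient_category_def)
  qed
  show "cat_comp (quotient_category C Rel) (arrow_class C Rel p) (arrow_class C Rel q) =
      arrow_class C Rel (cat_comp C p q)"
    if "p \<in> arr C" "q \<in> arr C" "tgt C p = src C q"
  proof -
    have eq: "arrow_class C Rel (cat_comp C p' q') = arrow_class C Rel (cat_comp C p q)"
      if "p' \<in> arrow_class C Rel p" "q' \<in> arrow_class C Rel q" for p' q'
    proof -
      have "(cat_comp C p q, cat_comp C p' q') \<in> congruence C Rel"
        using that \<open>tgt C p = src C q\<close> by (intro congruence.comp) (simp_all add: arrow_class_def)
      from equiv_class_eq[OF eqv this] show ?thesis by (simp add: arrow_class_def)
    qed
    have "(\<Union>p'\<in>arrow_class C Rel p. \<Union>q'\<in>arrow_class C Rel q.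
        arrow_class C Rel (cat_comp C p' q')) = arrow_class C Rel (cat_comp C p q)"
      using eq self[OF that(1)] self[OF that(2)] by blast
    then show ?thesis by (simp add: quotient_category_def)
  qed
qed

lemma category_quotient_category:
  assumes "category C" "Rel \<subseteq> parallel_pairs C"
  shows "category (quotient_category C Rel)"
  using assms(1) unfolding category_def wf_digraph_def
  by (simp add: quotient_category_simps[OF assms])
    (auto simp: quotient_category_simps(3,4)[OF assms])

section \<open>Actions, extensions and Kan extensions\<close>

text \<open>\<open>act K z c\<close> is \<open>z \<cdot> c\<close>. The sets \<open>elts K B\<close> are subsets of one type and need not be disjoint.\<close>

record ('o, 'a, 'x) action =
  elts :: "'o \<Rightarrow> 'x set"
  act :: "'x \<Rightarrow> 'a \<Rightarrow> 'x"

definition graph_action :: "('o, 'a) pre_digraph \<Rightarrow> ('o, 'a, 'x) action \<Rightarrow> bool" where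
  "graph_action G K \<longleftrightarrow> (\<forall>a\<in>arcs G. \<forall>z\<in>elts K (tail G a). act K z a \<in> elts K (head G a))"

definition category_action :: "('o, 'a) cat \<Rightarrow> ('o, 'a, 'x) action \<Rightarrow> bool" where
  "category_action C K \<longleftrightarrow>
     graph_action (ugraph C) K \<and>
     (\<forall>B\<in>obj C. \<forall>z\<in>elts K B. act K z (cat_id C B) = z) \<and>
     (\<forall>c\<in>arr C. \<forall>d\<in>arr C. tgt C c = src C d \<longrightarrow>
        (\<forall>z\<in>elts K (src C c). act K (act K z c) d = act K z (cat_comp C c d)))"

definition natural_transformation ::
  "('o, 'a) cat \<Rightarrow> ('o, 'a, 'x) action \<Rightarrow> ('o, 'a, 'y) action \<Rightarrow> ('o \<Rightarrow> 'x \<Rightarrow> 'y) \<Rightarrow> bool" where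
  "natural_transformation C K K' \<alpha> \<longleftrightarrow>
     \<alpha> \<in> (\<Pi>\<^sub>E B\<in>obj C. elts K B \<rightarrow>\<^sub>E elts K' B) \<and>
     (\<forall>b\<in>arr C. \<forall>z\<in>elts K (src C b). \<alpha> (tgt C b) (act K z b) = act K' (\<alpha> (src C b) z) b)"

definition is_extension ::
  "('o1, 'a1) cat \<Rightarrow> ('o2, 'a2) cat \<Rightarrow> ('o1, 'a1, 'x) action \<Rightarrow> ('o1, 'a1, 'o2, 'a2) mor \<Rightarrow>
   ('o2, 'a2, 'y) action \<Rightarrow> ('o1 \<Rightarrow> 'x \<Rightarrow> 'y) \<Rightarrow> bool" where
  "is_extension A B X F K \<epsilon> \<longleftrightarrow>
     category_action B K \<and>
     (\<forall>A1\<in>obj A. \<epsilon> A1 \<in> elts X A1 \<rightarrow> elts K (on_obj F A1)) \<and>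
     (\<forall>a\<in>arr A. \<forall>x\<in>elts X (src A a).
        \<epsilon> (tgt A a) (act X x a) = act K (\<epsilon> (src A a) x) (on_arr F a))"

text \<open>HOL cannot quantify over types inside a formula, so the type \<open>'z\<close> in which the competing
  extensions take their values is a parameter. A theorem about \<open>is_kan_extension TYPE('z)\<close>
  with \<open>'z\<close> a free type variable covers all of them.\<close>

definition is_kan_extension ::
  "'z itself \<Rightarrow> ('o1, 'a1) cat \<Rightarrow> ('o2, 'a2) cat \<Rightarrow> ('o1, 'a1, 'x) action \<Rightarrow>
   ('o1, 'a1, 'o2, 'a2) mor \<Rightarrow> ('o2, 'a2, 'y) action \<Rightarrow> ('o1 \<Rightarrow> 'x \<Rightarrow> 'y) \<Rightarrow> bool" where
  "is_kan_extension Z A B X F K \<epsilon> \<longleftrightarrow>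
     is_extension A B X F K \<epsilon> \<and>
     (\<forall>(K' :: ('o2, 'a2, 'z) action) \<epsilon>'. is_extension A B X F K' \<epsilon>' \<longrightarrow>
        (\<exists>!\<alpha>. natural_transformation B K K' \<alpha> \<and>
           (\<forall>A1\<in>obj A. \<forall>x\<in>elts X A1. \<epsilon>' A1 x = \<alpha> (on_obj F A1) (\<epsilon> A1 x))))"

section \<open>Rewriting\<close>

text \<open>The reduction relation generated by \<open>(RT, RP)\<close> on a set \<open>T\<close> with a target function \<open>\<tau>\<close> and a
  partial right action \<open>dot\<close> of the arrows of \<open>P\<close>, where \<open>dot t q\<close> is meaningful only if
  \<open>src P q = \<tau> t\<close>.\<close>

inductive reduction ::
  "('o, 'p) cat \<Rightarrow> 't set \<Rightarrow> ('t \<Rightarrow> 'o) \<Rightarrow> ('t \<Rightarrow> 'p \<Rightarrow> 't) \<Rightarrow> ('t \<times> 't) set \<Rightarrow> ('p \<times> 'p) set \<Rightarrow>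
   't \<Rightarrow> 't \<Rightarrow> bool"
  for P T \<tau> dot RT RP where
  term_rule: "(s, u) \<in> RT \<Longrightarrow> q \<in> arr P \<Longrightarrow> src P q = \<tau> s \<Longrightarrow> src P q = \<tau> u \<Longrightarrow>
    reduction P T \<tau> dot RT RP (dot s q) (dot u q)"
| path_rule: "(l, r) \<in> RP \<Longrightarrow> s \<in> T \<Longrightarrow> src P l = \<tau> s \<Longrightarrow> q \<in> arr P \<Longrightarrow> src P q = tgt P l \<Longrightarrow>
    reduction P T \<tau> dot RT RP (dot s (cat_comp P l q)) (dot s (cat_comp P r q))"

text \<open>The term \<open>x|p\<close> with \<open>x\<close> in the set \<open>elts X A\<close> is the triple \<open>(A, x, p)\<close>. The tag \<open>A\<close> makes
  the union over the objects disjoint; no tag is needed for \<open>B\<close>, which is the target of \<open>p\<close>.\<close>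

type_synonym ('a, 'x, 'p) kan_term = "'a \<times> 'x \<times> 'p"

definition kan_terms ::
  "('a, 'e) pre_digraph \<Rightarrow> ('o, 'p) cat \<Rightarrow> ('a, 'e, 'x) action \<Rightarrow> ('a, 'e, 'o, 'p) mor \<Rightarrow>
   ('a, 'x, 'p) kan_term set" where
  "kan_terms \<Gamma> P X F =
     {(A, x, p). A \<in> verts \<Gamma> \<and> x \<in> elts X A \<and> p \<in> arr P \<and> src P p = on_obj F A}"

definition term_target :: "('o, 'p) cat \<Rightarrow> ('a, 'x, 'p) kan_term \<Rightarrow> 'o" where
  "term_target P = (\<lambda>(A, x, p). tgt P p)"

definition term_dot ::
  "('o, 'p) cat \<Rightarrow> ('a, 'x, 'p) kan_term \<Rightarrow> 'p \<Rightarrow> ('a, 'x, 'p) kan_term" where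
  "term_dot P = (\<lambda>(A, x, p) q. (A, x, cat_comp P p q))"

definition epsilon_rules ::
  "('a, 'e) pre_digraph \<Rightarrow> ('o, 'p) cat \<Rightarrow> ('a, 'e, 'x) action \<Rightarrow> ('a, 'e, 'o, 'p) mor \<Rightarrow>
   (('a, 'x, 'p) kan_term \<times> ('a, 'x, 'p) kan_term) set" where
  "epsilon_rules \<Gamma> P X F =
     {((tail \<Gamma> a, x, on_arr F a), (head \<Gamma> a, act X x a, cat_id P (on_obj F (head \<Gamma> a)))) | a x.
        a \<in> arcs \<Gamma> \<and> x \<in> elts X (tail \<Gamma> a)}"

text \<open>The constant \<open>equivclp\<close> is the reflexive, symmetric and transitive closure on the whole type.\<close>

definition kan_conv ::
  "('a, 'e) pre_digraph \<Rightarrow> ('o, 'p) cat \<Rightarrow> ('p \<times> 'p) set \<Rightarrow> ('a, 'e, 'x) action \<Rightarrow>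
   ('a, 'e, 'o, 'p) mor \<Rightarrow> ('a, 'x, 'p) kan_term \<Rightarrow> ('a, 'x, 'p) kan_term \<Rightarrow> bool" where
  "kan_conv \<Gamma> P RelB X F =
     equivclp (reduction P (kan_terms \<Gamma> P X F) (term_target P) (term_dot P)
       (epsilon_rules \<Gamma> P X F) RelB)"

definition kan_class ::
  "('a, 'e) pre_digraph \<Rightarrow> ('o, 'p) cat \<Rightarrow> ('p \<times> 'p) set \<Rightarrow> ('a, 'e, 'x) action \<Rightarrow>
   ('a, 'e, 'o, 'p) mor \<Rightarrow> ('a, 'x, 'p) kan_term \<Rightarrow> ('a, 'x, 'p) kan_term set" where
  "kan_class \<Gamma> P RelB X F t = {t'. kan_conv \<Gamma> P RelB X F t t'}"

definition class_target :: "('o, 'p) cat \<Rightarrow> ('a, 'x, 'p) kan_term set \<Rightarrow> 'o" where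
  "class_target P c = the_elem (term_target P ` c)"

text \<open>Again the union over all representatives returns their common value, provided that the
  action is well defined.\<close>

definition kan_action ::
  "('a, 'e) pre_digraph \<Rightarrow> ('o, 'p) cat \<Rightarrow> ('p \<times> 'p) set \<Rightarrow> ('a, 'e, 'x) action \<Rightarrow>
   ('a, 'e, 'o, 'p) mor \<Rightarrow> ('o, 'p set, ('a, 'x, 'p) kan_term set) action" where
  "kan_action \<Gamma> P RelB X F =
     \<lparr>elts = (\<lambda>B. {kan_class \<Gamma> P RelB X F t | t.
         t \<in> kan_terms \<Gamma> P X F \<and> class_target P (kan_class \<Gamma> P RelB X F t) = B}),
      act = (\<lambda>c b. \<Union>t\<in>c. \<Union>p\<in>b. kan_class \<Gamma> P RelB X F (term_dot P t p))\<rparr>"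

definition kan_unit ::
  "('a, 'e) pre_digraph \<Rightarrow> ('o, 'p) cat \<Rightarrow> ('p \<times> 'p) set \<Rightarrow> ('a, 'e, 'x) action \<Rightarrow>
   ('a, 'e, 'o, 'p) mor \<Rightarrow> 'a \<Rightarrow> 'x \<Rightarrow> ('a, 'x, 'p) kan_term set" where
  "kan_unit \<Gamma> P RelB X F A x = kan_class \<Gamma> P RelB X F (A, x, cat_id P (on_obj F A))"

end

(*
  Substituting paths on the right makes the target and the class of a term compatible with the
  rewriting, so the terms modulo conversion form an action of the quotient category. Given another
  extension (K', \<epsilon>'), sending the class of x|p to \<epsilon>' x \<cdot> [p] is forced by naturality, because
  [x|p] = [x|id] \<cdot> [p]. It is well defined because each \<epsilon>-rule is an instance of the naturality
  of \<epsilon>', and each path rule is an equation in the quotient category. That the unit is natural for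
  all arrows of A, and not only for those of the generating graph, uses that A is generated.
*)

theory Submission
  imports Defs
begin

section \<open>Elementary laws of categories and actions\<close>

lemma
  assumes "category C"
  shows category_id: "B \<in> obj C \<Longrightarrow> cat_id C B \<in> arr C" "B \<in> obj C \<Longrightarrow> src C (cat_id C B) = B"
      "B \<in> obj C \<Longrightarrow> tgt C (cat_id C B) = B"
    and category_comp: "p \<in> arr C \<Longrightarrow> q \<in> arr C \<Longrightarrow> tgt C p = src C q \<Longrightarrow> cat_comp C p q \<in> arr C"
      "p \<in> arr C \<Longrightarrow> q \<in> arr C \<Longrightarrow> tgt C p = src C q \<Longrightarrow> src C (cat_comp C p q) = src C p"
      "p \<in> arr C \<Longrightarrow> q \<in> arr C \<Longrightarrow> tgt C p = src C q \<Longrightarrow> tgt C (cat_comp C p q) = tgt C q"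
    and category_unit: "p \<in> arr C \<Longrightarrow> cat_comp C (cat_id C (src C p)) p = p"
      "p \<in> arr C \<Longrightarrow> cat_comp C p (cat_id C (tgt C p)) = p"
    and category_assoc: "p \<in> arr C \<Longrightarrow> q \<in> arr C \<Longrightarrow> r \<in> arr C \<Longrightarrow> tgt C p = src C q \<Longrightarrow>
      tgt C q = src C r \<Longrightarrow> cat_comp C (cat_comp C p q) r = cat_comp C p (cat_comp C q r)"
    and category_ends: "p \<in> arr C \<Longrightarrow> src C p \<in> obj C" "p \<in> arr C \<Longrightarrow> tgt C p \<in> obj C"
  using assms unfolding category_def wf_digraph_def by blast+

lemma
  assumes "category_action C K"
  shows category_action_closed: "c \<in> arr C \<Longrightarrow> z \<in> elts K (src C c) \<Longrightarrow> act K z c \<in> elts K (tgt C c)"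
    and category_action_id: "B \<in> obj C \<Longrightarrow> z \<in> elts K B \<Longrightarrow> act K z (cat_id C B) = z"
    and category_action_comp: "c \<in> arr C \<Longrightarrow> d \<in> arr C \<Longrightarrow> tgt C c = src C d \<Longrightarrow>
      z \<in> elts K (src C c) \<Longrightarrow> act K z (cat_comp C c d) = act K (act K z c) d"
  using assms by (simp_all add: category_action_def graph_action_def)

section \<open>Terms and the partial right action of \<open>P\<close> on them\<close>

locale kan_presentation =
  fixes \<Gamma> :: "('a, 'e) pre_digraph" and P :: "('o, 'p) cat" and RelB :: "('p \<times> 'p) set"
    and X :: "('a, 'e, 'x) action" and F :: "('a, 'e, 'o, 'p) mor"
  assumes wf_graph: "wf_digraph \<Gamma>" and cat: "category P"
    and rel: "RelB \<subseteq> parallel_pairs P"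
    and graph_act: "graph_action \<Gamma> X"
    and morphism: "graph_morphism \<Gamma> (ugraph P) F"
begin

abbreviation "B \<equiv> quotient_category P RelB"
abbreviation "T \<equiv> kan_terms \<Gamma> P X F"
abbreviation "\<tau> \<equiv> term_target P"
abbreviation "dot \<equiv> term_dot P"
abbreviation "red \<equiv> reduction P T \<tau> dot (epsilon_rules \<Gamma> P X F) RelB"
abbreviation "conv \<equiv> kan_conv \<Gamma> P RelB X F"
abbreviation "cls \<equiv> kan_class \<Gamma> P RelB X F"
abbreviation "path_cls \<equiv> arrow_class P RelB"
abbreviation "K \<equiv> kan_action \<Gamma> P RelB X F"
abbreviation "\<epsilon> \<equiv> kan_unit \<Gamma> P RelB X F"

lemmas cat_simps = category_id[OF cat] category_comp[OF cat] category_unit[OF cat]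
  category_assoc[OF cat] category_ends[OF cat]
lemmas quotient_simps = quotient_category_simps[OF cat rel]

lemma dot_closed:
  assumes "t \<in> T" "p \<in> arr P" "src P p = \<tau> t"
  shows "dot t p \<in> T" "\<tau> (dot t p) = tgt P p"
  using assms by (auto simp: kan_terms_def term_target_def term_dot_def cat_simps)

lemma target_in_obj: "t \<in> T \<Longrightarrow> \<tau> t \<in> obj P"
  by (auto simp: kan_terms_def term_target_def cat_simps)

lemma dot_id: "t \<in> T \<Longrightarrow> dot t (cat_id P (\<tau> t)) = t"
  by (auto simp: kan_terms_def term_target_def term_dot_def cat_simps)

lemma dot_comp:
  assumes "t \<in> T" "p \<in> arr P" "q \<in> arr P" "src P p = \<tau> t" "tgt P p = src P q"
  shows "dot t (cat_comp P p q) = dot (dot t p) q"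
  using assms by (auto simp: kan_terms_def term_target_def term_dot_def cat_simps)

lemma unit_term:
  assumes "A \<in> verts \<Gamma>" "x \<in> elts X A"
  shows "(A, x, cat_id P (on_obj F A)) \<in> T" "\<tau> (A, x, cat_id P (on_obj F A)) = on_obj F A"
  using assms morphism
  by (auto simp: kan_terms_def term_target_def cat_simps graph_morphism_def)

text \<open>The left unit law in \<open>P\<close>. It exhibits every term as a translate of a term
  with identity path, which later shows that the image of the unit generates \<open>K\<close> under
  the action.\<close>

lemma term_eq_dot_unit:
  assumes "(A, x, p) \<in> T"
  shows "(A, x, p) = dot (A, x, cat_id P (on_obj F A)) p"
  using assms cat_simps(7)[of p] by (auto simp: kan_terms_def term_dot_def)

lemma epsilon_rules_closed:
  assumes "(s, u) \<in> epsilon_rules \<Gamma> P X F"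
  shows "s \<in> T" "u \<in> T" "\<tau> s = \<tau> u"
  using assms morphism graph_act wf_graph
  by (auto simp: epsilon_rules_def kan_terms_def term_target_def graph_morphism_def
      graph_action_def wf_digraph_def cat_simps)

lemma rel_parallel:
  assumes "(l, r) \<in> RelB"
  shows "l \<in> arr P" "r \<in> arr P" "src P l = src P r" "tgt P l = tgt P r"
  using rel assms by (auto simp: parallel_pairs_def)

section \<open>Reduction, conversion and their compatibility with the right action\<close>

lemma reduction_closed:
  assumes "red t t'"
  shows "t \<in> T \<and> t' \<in> T \<and> \<tau> t = \<tau> t'"
  using assms
proof cases
  case (term_rule s u q)
  then show ?thesis using epsilon_rules_closed[of s u] by (simp add: dot_closed)
next
  case (path_rule l r s q)
  then show ?thesis using rel_parallel[of l r] by (simp add: dot_closed cat_simps)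
qed

text \<open>Both kinds of reduction already carry an arbitrary trailing arrow \<open>q\<close>, so a
  further arrow \<open>p\<close> is absorbed by associativity: the same rule is applied with
  \<open>cat_comp P q p\<close> in place of \<open>q\<close>.\<close>

lemma reduction_dot:
  assumes "red t t'" "p \<in> arr P" "src P p = \<tau> t"
  shows "red (dot t p) (dot t' p)"
  using assms(1)
proof cases
  case (term_rule s u q)
  note su = epsilon_rules_closed[OF term_rule(3)]
  have pq: "tgt P q = src P p" using term_rule su assms(3) by (simp add: dot_closed)
  have "red (dot s (cat_comp P q p)) (dot u (cat_comp P q p))"
    using term_rule su assms(2) pq by (intro reduction.term_rule) (simp_all add: cat_simps)
  then show ?thesis using term_rule su assms(2) pq by (simp add: dot_comp)
next
  case (path_rule l r s q)
  note lr = rel_parallel[OF path_rule(3)]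
  have pq: "tgt P q = src P p" using path_rule lr assms(3) by (simp add: dot_closed cat_simps)
  have "red (dot s (cat_comp P l (cat_comp P q p))) (dot s (cat_comp P r (cat_comp P q p)))"
    using path_rule assms(2) pq by (intro reduction.path_rule) (simp_all add: cat_simps)
  then show ?thesis using path_rule lr assms(2) pq by (simp add: dot_comp dot_closed cat_simps)
qed

lemma conv_refl: "conv t t"
  and conv_sym: "conv t t' \<Longrightarrow> conv t' t"
  and conv_trans: "conv t t' \<Longrightarrow> conv t' t'' \<Longrightarrow> conv t t''"
  and reduction_imp_conv: "red t t' \<Longrightarrow> conv t t'"
  unfolding kan_conv_def by (auto intro: equivclp_sym equivclp_trans)

text \<open>A conversion is a finite chain of reductions, each traversed forwards or backwards. The
  two directions become separate cases, so an invariant need only be checked for a single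
  reduction.\<close>

lemma conv_induct [consumes 1, case_names refl step sym]:
  assumes "conv t t'" "Q t"
    and "\<And>u u'. red u u' \<Longrightarrow> Q u \<Longrightarrow> Q u'" "\<And>u u'. red u u' \<Longrightarrow> Q u' \<Longrightarrow> Q u"
  shows "Q t'"
  using assms(1,2) unfolding kan_conv_def
  by (induction rule: equivclp_induct) (auto dest: assms(3,4))

text \<open>Since the closure lives on the whole type, a term outside \<open>T\<close> is
  convertible to itself. Reductions relate only elements of \<open>T\<close> with equal targets, so
  a chain that starts in \<open>T\<close> stays there and keeps its target.\<close>

lemma conv_closed:
  assumes "conv t t'" "t \<in> T"
  shows "t' \<in> T" "\<tau> t' = \<tau> t"
proof -
  from assms(1) have "t' \<in> T \<and> \<tau> t' = \<tau> t"
    by (induction rule: conv_induct) (auto simp: assms(2) dest: reduction_closed)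
  then show "t' \<in> T" "\<tau> t' = \<tau> t" by simp_all
qed

lemma conv_dot:
  assumes "conv t t'" "p \<in> arr P" "src P p = \<tau> t"
  shows "conv (dot t p) (dot t' p)"
proof -
  \<comment> \<open>The equality of targets is carried through the induction because translating the
    next reduction by \<open>p\<close> requires \<open>src P p\<close> to be the target of the
    current term.\<close>
  from assms(1) have "\<tau> t' = \<tau> t \<and> conv (dot t p) (dot t' p)"
  proof (induction rule: conv_induct)
    case refl
    show ?case by (simp add: conv_refl)
  next
    case (step u u')
    then show ?case
      using reduction_closed[of u u'] reduction_imp_conv[OF reduction_dot, of u u' p] assms(2,3)
      by (auto intro: conv_trans)
  next
    case (sym u u')
    then show ?case
      using reduction_closed[of u u'] reduction_imp_conv[OF reduction_dot, of u u' p] assms(2,3)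
      by (auto intro: conv_trans conv_sym)
  qed
  then show ?thesis by simp
qed

text \<open>Induction on the generation of the congruence, for all terms \<open>t\<close> at once:
  in a composite, the second factor acts on a translate of \<open>t\<close> and not on
  \<open>t\<close> itself.\<close>

lemma conv_congruence:
  assumes "(p, q) \<in> congruence P RelB" "t \<in> T" "src P p = \<tau> t"
  shows "conv (dot t p) (dot t q)"
  using assms
proof (induction arbitrary: t)
  case (base l r)
  note lr = rel_parallel[OF base(1)]
  \<comment> \<open>A generating pair is a path rule whose trailing arrow is an identity, which the
    right unit law removes afterwards.\<close>
  have "red (dot t (cat_comp P l (cat_id P (tgt P l)))) (dot t (cat_comp P r (cat_id P (tgt P l))))"
    using base lr by (intro reduction.path_rule) (simp_all add: cat_simps)
  then show ?case
    using cat_simps(8)[OF lr(1)] cat_simps(8)[OF lr(2)] lr(4) by (simp add: reduction_imp_conv)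
next
  case (refl p)
  show ?case by (rule conv_refl)
next
  case (sym p q)
  then have "src P p = \<tau> t"
    using congruence_parallel[OF cat rel sym(1)] by (simp add: parallel_pairs_def)
  with sym show ?case by (intro conv_sym[OF sym.IH])
next
  case (trans p q r)
  then have "src P q = \<tau> t"
    using congruence_parallel[OF cat rel trans(1)] by (simp add: parallel_pairs_def)
  with trans show ?case by (intro conv_trans[OF trans.IH])
next
  case (comp p p' q q')
  have par: "p \<in> arr P" "p' \<in> arr P" "q \<in> arr P" "q' \<in> arr P"
      "src P p = src P p'" "tgt P p = tgt P p'"
    using congruence_parallel[OF cat rel comp(1)] congruence_parallel[OF cat rel comp(2)]
    by (simp_all add: parallel_pairs_def)
  have qq: "src P q = src P q'"
    using congruence_parallel[OF cat rel comp(2)] by (simp add: parallel_pairs_def)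
  have src: "src P p = \<tau> t" using comp.prems par comp.hyps by (simp add: cat_simps)
  \<comment> \<open>The factors are exchanged one at a time: first \<open>p\<close> with
    \<open>q\<close> held fixed, by translating the induction hypothesis for \<open>p\<close>, then
    \<open>q\<close> acting on \<open>dot t p'\<close>.\<close>
  have "conv (dot (dot t p) q) (dot (dot t p') q)"
    using comp src par by (intro conv_dot) (simp_all add: dot_closed)
  moreover have "conv (dot (dot t p') q) (dot (dot t p') q')"
    using comp src par by (intro comp.IH(2)) (simp_all add: dot_closed)
  ultimately show ?case
    using comp.prems comp.hyps src par qq by (simp add: dot_comp) (rule conv_trans)
qed

section \<open>Classes of terms and the action \<open>K\<close>\<close>

lemma cls_eq_iff: "cls t = cls t' \<longleftrightarrow> conv t t'"
proof
  show "conv t t'" if "cls t = cls t'"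
  proof -
    have "t' \<in> cls t'" by (simp add: kan_class_def conv_refl)
    then have "t' \<in> cls t" using that by simp
    then show ?thesis by (simp add: kan_class_def)
  qed
  show "cls t = cls t'" if "conv t t'"
    unfolding kan_class_def using that by (blast intro: conv_sym conv_trans)
qed

lemma mem_cls_iff: "t' \<in> cls t \<longleftrightarrow> conv t t'"
  by (simp add: kan_class_def)

lemma class_target_cls:
  assumes "t \<in> T"
  shows "class_target P (cls t) = \<tau> t"
proof -
  have "\<tau> ` cls t = {\<tau> t}"
    using conv_closed[OF _ assms] conv_refl[of t] by (force simp: mem_cls_iff)
  then show ?thesis by (simp add: class_target_def)
qed

text \<open>The term and the path are replaced in turn, passing through \<open>dot t' p\<close>.
  This is the independence of both representatives that makes the action well defined.\<close>

lemma cls_dot_cong: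
  assumes "t \<in> T" "p \<in> arr P" "src P p = \<tau> t" "conv t t'" "(p, p') \<in> congruence P RelB"
  shows "cls (dot t p) = cls (dot t' p')"
  using conv_trans[OF conv_dot[OF assms(4,2,3)] conv_congruence[OF assms(5)]]
    conv_closed[OF assms(4,1)] assms(3) by (simp add: cls_eq_iff)

text \<open>By \<open>cls_dot_cong\<close> all members of the double union defining
  \<open>act K\<close> are the same class, and the index sets are nonempty since \<open>t\<close>
  and \<open>p\<close> lie in their own classes, so the union collapses to that class.\<close>

lemma act_cls:
  assumes "t \<in> T" "p \<in> arr P" "src P p = \<tau> t"
  shows "act K (cls t) (path_cls p) = cls (dot t p)"
proof -
  have "cls (dot t' p') = cls (dot t p)" if "t' \<in> cls t" "p' \<in> path_cls p" for t' p'
    using cls_dot_cong[OF assms, of t' p'] that by (simp add: mem_cls_iff arrow_class_def)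
  moreover have "t \<in> cls t" "p \<in> path_cls p"
    using assms(2) by (auto simp: mem_cls_iff conv_refl arrow_class_def intro: congruence.refl)
  ultimately show ?thesis by (fastforce simp: kan_action_def)
qed

lemma elts_K: "elts K b = cls ` {t \<in> T. \<tau> t = b}"
  unfolding kan_action_def by (force simp: class_target_cls simp del: split_paired_Ex)

text \<open>Every element is the class of a term and every arrow of \<open>B\<close> the class of a
  path, so \<open>act_cls\<close> reduces the action laws to the corresponding laws of
  \<open>dot\<close> on terms.\<close>

lemma category_action_K: "category_action B K"
  unfolding category_action_def graph_action_def
  by (auto simp: quotient_simps elts_K act_cls dot_closed dot_comp dot_id cat_simps target_in_obj)

lemma act_unit:
  assumes "(A, x, p) \<in> T"
  shows "act K (\<epsilon> A x) (path_cls p) = cls (A, x, p)"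
proof -
  have t: "A \<in> verts \<Gamma>" "x \<in> elts X A" "p \<in> arr P" "src P p = on_obj F A"
    using assms by (simp_all add: kan_terms_def)
  show ?thesis
    using act_cls[OF unit_term(1)[OF t(1,2)] t(3)] unit_term(2)[OF t(1,2)] t(4)
      term_eq_dot_unit[OF assms] by (simp add: kan_unit_def)
qed

end

section \<open>The unit as an extension along \<open>F'\<close>\<close>

locale kan_presentation_functor = kan_presentation \<Gamma> P RelB X F
  for \<Gamma> :: "('a, 'e) pre_digraph" and P :: "('o, 'p) cat" and RelB :: "('p \<times> 'p) set"
    and X :: "('a, 'e, 'x) action" and F :: "('a, 'e, 'o, 'p) mor" +
  fixes A :: "('a, 'c) cat" and \<iota> :: "'e \<Rightarrow> 'c"
    and X' :: "('a, 'c, 'x) action" and F' :: "('a, 'c, 'o, 'p set) mor"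
  assumes catA: "category A" and gen: "generated_by A \<Gamma> \<iota>"
    and actX': "category_action A X'"
    and elts_X': "\<And>a. a \<in> verts \<Gamma> \<Longrightarrow> elts X' a = elts X a"
    and act_X': "\<And>a x. a \<in> arcs \<Gamma> \<Longrightarrow> x \<in> elts X (tail \<Gamma> a) \<Longrightarrow> act X' x (\<iota> a) = act X x a"
    and is_functor_F': "is_functor A B F'"
    and obj_F': "\<And>a. a \<in> verts \<Gamma> \<Longrightarrow> on_obj F' a = on_obj F a"
    and arr_F': "\<And>a. a \<in> arcs \<Gamma> \<Longrightarrow> on_arr F' (\<iota> a) = path_cls (on_arr F a)"
begin

lemma obj_A: "obj A = verts \<Gamma>"
  and arr_A: "arr A = generated_arrows A (\<iota> ` arcs \<Gamma>)"
  and iota: "a \<in> arcs \<Gamma> \<Longrightarrow> \<iota> a \<in> arr A" "a \<in> arcs \<Gamma> \<Longrightarrow> src A (\<iota> a) = tail \<Gamma> a"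
    "a \<in> arcs \<Gamma> \<Longrightarrow> tgt A (\<iota> a) = head \<Gamma> a"
  using gen unfolding generated_by_def graph_morphism_def by auto

lemma graph_ends: "a \<in> arcs \<Gamma> \<Longrightarrow> tail \<Gamma> a \<in> verts \<Gamma>" "a \<in> arcs \<Gamma> \<Longrightarrow> head \<Gamma> a \<in> verts \<Gamma>"
  using wf_graph by (simp_all add: wf_digraph_def)

lemma F'_simps:
  shows "a \<in> arr A \<Longrightarrow> on_arr F' a \<in> arr B"
    and "a \<in> arr A \<Longrightarrow> src B (on_arr F' a) = on_obj F' (src A a)"
    and "a \<in> arr A \<Longrightarrow> tgt B (on_arr F' a) = on_obj F' (tgt A a)"
    and "v \<in> obj A \<Longrightarrow> on_arr F' (cat_id A v) = cat_id B (on_obj F' v)"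
    and "v \<in> obj A \<Longrightarrow> on_obj F' v \<in> obj B"
    and "a \<in> arr A \<Longrightarrow> a' \<in> arr A \<Longrightarrow> tgt A a = src A a' \<Longrightarrow>
      on_arr F' (cat_comp A a a') = cat_comp B (on_arr F' a) (on_arr F' a')"
  using is_functor_F' by (simp_all add: is_functor_def graph_morphism_def)

lemma unit_in_K: "v \<in> obj A \<Longrightarrow> x \<in> elts X' v \<Longrightarrow> \<epsilon> v x \<in> elts K (on_obj F' v)"
  using unit_term[of v x] by (auto simp: obj_A elts_X' obj_F' elts_K kan_unit_def)

text \<open>Acting on the unit by the class of \<open>F a\<close> gives the class of
  \<open>x|F a\<close>, and the epsilon rule for \<open>a\<close> and \<open>x\<close> identifies it
  with \<open>(x . a)|id\<close>, whose class is the unit at \<open>x . a\<close>.\<close>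

lemma unit_natural_generator:
  assumes a: "a \<in> arcs \<Gamma>" and x: "x \<in> elts X (tail \<Gamma> a)"
  shows "\<epsilon> (head \<Gamma> a) (act X x a) = act K (\<epsilon> (tail \<Gamma> a) x) (path_cls (on_arr F a))"
proof -
  let ?s = "(tail \<Gamma> a, x, on_arr F a)"
  let ?u = "(head \<Gamma> a, act X x a, cat_id P (on_obj F (head \<Gamma> a)))"
  have rule: "(?s, ?u) \<in> epsilon_rules \<Gamma> P X F"
    using a x by (auto simp: epsilon_rules_def)
  note su = epsilon_rules_closed[OF rule]
  \<comment> \<open>The rule itself as a reduction: the trailing arrow is the identity at the common
    target, and \<open>dot_id\<close> then removes it on both sides.\<close>
  have "red (dot ?s (cat_id P (\<tau> ?s))) (dot ?u (cat_id P (\<tau> ?s)))"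
    using rule su target_in_obj[OF su(1)]
    by (intro reduction.term_rule) (simp_all add: cat_simps)
  then have "red ?s ?u" using dot_id[OF su(1)] dot_id[OF su(2)] su(3) by simp
  then have "cls ?s = cls ?u" by (simp add: cls_eq_iff reduction_imp_conv)
  then show ?thesis using act_unit[OF su(1)] by (simp add: kan_unit_def)
qed

text \<open>Induction on the generation of \<open>arr A\<close> by the arrows of the graph.
  Naturality squares paste along composites because \<open>X'\<close> and \<open>K\<close> are
  actions and \<open>F'\<close> is a functor; \<open>x\<close> is kept arbitrary since the second
  square is used at \<open>act X' x p\<close>.\<close>

lemma unit_natural:
  assumes "a \<in> arr A" "x \<in> elts X' (src A a)"
  shows "\<epsilon> (tgt A a) (act X' x a) = act K (\<epsilon> (src A a) x) (on_arr F' a)"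
  using assms unfolding arr_A
proof (induction arbitrary: x)
  case (ident v)
  then show ?case
    using unit_in_K[of v x] category_action_id[OF category_action_K, of "on_obj F' v"]
    by (simp add: category_id[OF catA] category_action_id[OF actX'] F'_simps)
next
  case (gen a)
  then obtain e where e: "a = \<iota> e" "e \<in> arcs \<Gamma>" by auto
  then show ?case
    using gen unit_natural_generator[of e x] by (simp add: iota elts_X' graph_ends act_X' arr_F')
next
  case (comp p q)
  have pq: "p \<in> arr A" "q \<in> arr A" using comp.hyps by (simp_all add: arr_A)
  have x: "x \<in> elts X' (src A p)" using comp pq by (simp add: category_comp[OF catA])
  have y: "act X' x p \<in> elts X' (src A q)"
    using category_action_closed[OF actX' pq(1) x] comp.hyps by simp
  have ex: "\<epsilon> (src A p) x \<in> elts K (src B (on_arr F' p))"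
    using unit_in_K[OF _ x] pq by (simp add: category_ends[OF catA] F'_simps)
  have "act K (\<epsilon> (src A p) x) (on_arr F' (cat_comp A p q)) =
      act K (act K (\<epsilon> (src A p) x) (on_arr F' p)) (on_arr F' q)"
    using category_action_comp[OF category_action_K _ _ _ ex] pq comp.hyps by (simp add: F'_simps)
  then show ?case
    using comp.IH(1)[OF x] comp.IH(2)[OF y] pq comp.hyps x
    by (simp add: category_comp[OF catA] category_action_comp[OF actX'])
qed

lemma is_extension_K: "is_extension A B X' F' K \<epsilon>"
  using category_action_K unit_in_K unit_natural by (simp add: is_extension_def)

section \<open>The mediating transformation into a competing extension\<close>

definition term_value :: "('o, 'p set, 'z) action \<Rightarrow> ('a \<Rightarrow> 'x \<Rightarrow> 'z) \<Rightarrow> ('a, 'x, 'p) kan_term \<Rightarrow> 'z"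
  where "term_value K' \<epsilon>' = (\<lambda>(v, x, p). act K' (\<epsilon>' v x) (path_cls p))"

context
  fixes K' :: "('o, 'p set, 'z) action" and \<epsilon>' :: "'a \<Rightarrow> 'x \<Rightarrow> 'z"
  assumes ext: "is_extension A B X' F' K' \<epsilon>'"
begin

lemma actK': "category_action B K'"
  and unit'_in: "v \<in> verts \<Gamma> \<Longrightarrow> x \<in> elts X v \<Longrightarrow> \<epsilon>' v x \<in> elts K' (on_obj F v)"
  and unit'_natural: "a \<in> arr A \<Longrightarrow> x \<in> elts X' (src A a) \<Longrightarrow>
    \<epsilon>' (tgt A a) (act X' x a) = act K' (\<epsilon>' (src A a) x) (on_arr F' a)"
  using ext unfolding is_extension_def obj_A
  by (blast, metis funcset_mem elts_X' obj_F', blast)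

lemma term_value_in:
  assumes "t \<in> T"
  shows "term_value K' \<epsilon>' t \<in> elts K' (\<tau> t)"
proof -
  obtain v x p where t: "t = (v, x, p)" by (cases t)
  then have tx: "v \<in> verts \<Gamma>" "x \<in> elts X v" "p \<in> arr P" "src P p = on_obj F v"
    using assms by (simp_all add: kan_terms_def)
  show ?thesis
    using category_action_closed[OF actK', of "path_cls p" "\<epsilon>' v x"] unit'_in[OF tx(1,2)] tx
    by (simp add: t term_value_def term_target_def quotient_simps)
qed

lemma term_value_dot:
  assumes "t \<in> T" "p \<in> arr P" "src P p = \<tau> t"
  shows "term_value K' \<epsilon>' (dot t p) = act K' (term_value K' \<epsilon>' t) (path_cls p)"
proof -
  obtain v x q where t: "t = (v, x, q)" by (cases t)
  have tx: "v \<in> verts \<Gamma>" "x \<in> elts X v" "q \<in> arr P" "src P q = on_obj F v" "tgt P q = src P p"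
    using assms t by (simp_all add: kan_terms_def term_target_def)
  have "act K' (\<epsilon>' v x) (cat_comp B (path_cls q) (path_cls p)) =
      act K' (act K' (\<epsilon>' v x) (path_cls q)) (path_cls p)"
    using tx assms(2) unit'_in[OF tx(1,2)]
    by (intro category_action_comp[OF actK']) (simp_all add: quotient_simps)
  then show ?thesis
    using tx assms(2) by (simp add: t term_value_def term_dot_def quotient_simps)
qed

lemma term_value_unit:
  assumes "v \<in> verts \<Gamma>" "x \<in> elts X v"
  shows "term_value K' \<epsilon>' (v, x, cat_id P (on_obj F v)) = \<epsilon>' v x"
  using category_action_id[OF actK' _ unit'_in[OF assms]] morphism assms(1)
  by (simp add: term_value_def quotient_simps graph_morphism_def)

text \<open>By \<open>term_value_dot\<close> a trailing arrow acts on the value through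
  \<open>K'\<close>, so it suffices to compare the two sides of a rule before \<open>q\<close> is
  appended.\<close>

lemma term_value_reduction:
  assumes "red t t'"
  shows "term_value K' \<epsilon>' t = term_value K' \<epsilon>' t'"
  using assms
proof cases
  case (term_rule s u q)
  note su = epsilon_rules_closed[OF term_rule(3)]
  obtain a x where a: "a \<in> arcs \<Gamma>" "x \<in> elts X (tail \<Gamma> a)" and s: "s = (tail \<Gamma> a, x, on_arr F a)"
    and u: "u = (head \<Gamma> a, act X x a, cat_id P (on_obj F (head \<Gamma> a)))"
    using term_rule(3) by (auto simp: epsilon_rules_def)
  have "act X x a \<in> elts X (head \<Gamma> a)" using graph_act a by (simp add: graph_action_def)
  then have "term_value K' \<epsilon>' u = \<epsilon>' (head \<Gamma> a) (act X x a)"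
    using term_value_unit graph_ends a(1) by (simp add: u)
  \<comment> \<open>Naturality of \<epsilon>' at the generator \<open>\<iota> a\<close>, which
    \<open>F'\<close> sends to the class of \<open>on_arr F a\<close>.\<close>
  also have "\<dots> = term_value K' \<epsilon>' s"
    using unit'_natural[of "\<iota> a" x] a
    by (simp add: s term_value_def iota elts_X' graph_ends act_X' arr_F')
  finally show ?thesis using term_rule su by (simp add: term_value_dot)
next
  case (path_rule l r s q)
  note lr = rel_parallel[OF path_rule(3)]
  \<comment> \<open>The pair becomes an equality in the quotient, and \<open>term_value\<close> sees
    a path only through its class.\<close>
  have "path_cls l = path_cls r"
    unfolding arrow_class_def
    by (rule equiv_class_eq[OF equiv_congruence[OF cat rel] congruence.base[OF path_rule(3)]])
  then show ?thesis
    using path_rule lr by (simp add: term_value_dot dot_comp dot_closed)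
qed

lemma term_value_conv: "conv t t' \<Longrightarrow> term_value K' \<epsilon>' t = term_value K' \<epsilon>' t'"
  by (induction rule: conv_induct) (auto dest: term_value_reduction)

text \<open>The representative picked by \<open>SOME\<close> is immaterial, as
  \<open>term_value\<close> is constant on conversion classes. Both abstractions are restricted to
  their domains because a natural transformation is required to be an extensional family of
  extensional functions.\<close>

definition mediating :: "'o \<Rightarrow> ('a, 'x, 'p) kan_term set \<Rightarrow> 'z" where
  "mediating =
     (\<lambda>b\<in>obj B. \<lambda>z\<in>elts K b. term_value K' \<epsilon>' (SOME t. t \<in> z))"

lemma mediating_cls:
  assumes "t \<in> T"
  shows "mediating (\<tau> t) (cls t) = term_value K' \<epsilon>' t"
proof -
  have "conv t (SOME t'. t' \<in> cls t)"
    using someI[of "\<lambda>t'. t' \<in> cls t" t] conv_refl by (simp add: mem_cls_iff)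
  moreover have "\<tau> t \<in> obj B" "cls t \<in> elts K (\<tau> t)"
    using assms by (auto simp: quotient_simps target_in_obj elts_K)
  ultimately show ?thesis by (simp add: mediating_def term_value_conv[symmetric])
qed

text \<open>With representatives \<open>t\<close> of the element and \<open>p\<close> of the arrow,
  both sides of the naturality equation are the value of the term \<open>dot t p\<close>.\<close>

lemma natural_transformation_mediating: "natural_transformation B K K' mediating"
  unfolding natural_transformation_def
proof (intro conjI ballI)
  have "mediating b z \<in> elts K' b" if "z \<in> elts K b" for b z
    using that mediating_cls term_value_in by (auto simp: elts_K)
  then have "mediating b \<in> elts K b \<rightarrow>\<^sub>E elts K' b" if "b \<in> obj B" for b
    by (rule PiE_I) (simp_all add: that mediating_def)
  then show "mediating \<in> (\<Pi>\<^sub>E b\<in>obj B. elts K b \<rightarrow>\<^sub>E elts K' b)"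
    by (rule PiE_I) (simp_all add: mediating_def)
next
  fix b z
  assume b: "b \<in> arr B" and z: "z \<in> elts K (src B b)"
  obtain p where p: "b = path_cls p" "p \<in> arr P" using b by (auto simp: quotient_simps)
  obtain t where t: "t \<in> T" "\<tau> t = src P p" "z = cls t"
    using z p by (auto simp: elts_K quotient_simps)
  show "mediating (tgt B b) (act K z b) = act K' (mediating (src B b) z) b"
    using mediating_cls[OF t(1)] mediating_cls[of "dot t p"] p t
    by (simp add: quotient_simps act_cls dot_closed term_value_dot)
qed

lemma mediating_unit:
  assumes "v \<in> verts \<Gamma>" "x \<in> elts X v"
  shows "mediating (on_obj F v) (\<epsilon> v x) = \<epsilon>' v x"
  using mediating_cls[OF unit_term(1)[OF assms]] unit_term(2)[OF assms] term_value_unit[OF assms]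
  by (simp add: kan_unit_def)

text \<open>Naturality along \<open>path_cls p\<close> is applied at the unit element
  \<open>\<epsilon> v x\<close>: by \<open>act_unit\<close> the left side is \<alpha> at the class
  of \<open>(v, x, p)\<close>, and by the triangle identity the right side is \<epsilon>' at
  \<open>x\<close> acted on by the class of \<open>p\<close>.\<close>

lemma natural_transformation_unique:
  assumes nat: "natural_transformation B K K' \<alpha>"
    and unit: "\<And>v x. v \<in> verts \<Gamma> \<Longrightarrow> x \<in> elts X v \<Longrightarrow> \<epsilon>' v x = \<alpha> (on_obj F v) (\<epsilon> v x)"
    and "t \<in> T"
  shows "\<alpha> (\<tau> t) (cls t) = term_value K' \<epsilon>' t"
proof -
  obtain v x p where t: "t = (v, x, p)" by (cases t)
  have tx: "v \<in> verts \<Gamma>" "x \<in> elts X v" "p \<in> arr P" "src P p = on_obj F v"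
    using \<open>t \<in> T\<close> t by (simp_all add: kan_terms_def)
  have "\<epsilon> v x \<in> elts K (src B (path_cls p))"
    using unit_term[OF tx(1,2)] tx by (auto simp: quotient_simps elts_K kan_unit_def)
  then have "\<alpha> (tgt B (path_cls p)) (act K (\<epsilon> v x) (path_cls p)) =
      act K' (\<alpha> (src B (path_cls p)) (\<epsilon> v x)) (path_cls p)"
    using nat tx(3) by (simp add: natural_transformation_def quotient_simps)
  then show ?thesis
    using act_unit[of v x p] \<open>t \<in> T\<close> tx unit[OF tx(1,2)]
    by (simp add: t term_value_def term_target_def quotient_simps)
qed

lemma ex1_mediating:
  "\<exists>!\<alpha>. natural_transformation B K K' \<alpha> \<and>
     (\<forall>v\<in>obj A. \<forall>x\<in>elts X' v. \<epsilon>' v x = \<alpha> (on_obj F' v) (\<epsilon> v x))"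
proof (intro ex1I conjI ballI)
  show "natural_transformation B K K' mediating" by (rule natural_transformation_mediating)
  show "\<epsilon>' v x = mediating (on_obj F' v) (\<epsilon> v x)" if "v \<in> obj A" "x \<in> elts X' v" for v x
    using that mediating_unit by (simp add: obj_A elts_X' obj_F')
next
  fix \<alpha>
  assume \<alpha>: "natural_transformation B K K' \<alpha> \<and>
    (\<forall>v\<in>obj A. \<forall>x\<in>elts X' v. \<epsilon>' v x = \<alpha> (on_obj F' v) (\<epsilon> v x))"
  then have val: "\<alpha> (\<tau> t) (cls t) = mediating (\<tau> t) (cls t)" if "t \<in> T" for t
    using that
    by (subst natural_transformation_unique) (auto simp: obj_A elts_X' obj_F' mediating_cls)
  have fam: "\<alpha> \<in> (\<Pi>\<^sub>E b\<in>obj B. elts K b \<rightarrow>\<^sub>E elts K' b)"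
      "mediating \<in> (\<Pi>\<^sub>E b\<in>obj B. elts K b \<rightarrow>\<^sub>E elts K' b)"
    using \<alpha> natural_transformation_mediating by (simp_all add: natural_transformation_def)
  show "\<alpha> = mediating"
  \<comment> \<open>Agreement on classes gives equality of functions by extensionality at two
    levels, first in the object and then in the element; by \<open>elts_K\<close> every element is
    the class of a term.\<close>
  proof (rule PiE_ext[OF fam])
    fix b assume b: "b \<in> obj B"
    show "\<alpha> b = mediating b"
      using val by (intro PiE_ext[OF PiE_mem[OF fam(1) b] PiE_mem[OF fam(2) b]]) (auto simp: elts_K)
  qed
qed

end

lemma is_kan_extension_K: "is_kan_extension TYPE('z) A B X' F' K \<epsilon>"
  unfolding is_kan_extension_def using is_extension_K ex1_mediating by blast

end

section \<open>The three statements for the free category on \<Delta>\<close>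

theorem mainTheorem1:
  fixes \<Gamma> :: "('a, 'e) pre_digraph" and \<Delta> :: "('o, 'd) pre_digraph"
    and P :: "('o, ('o, 'd) path) cat" and B :: "('o, ('o, 'd) path set) cat"
    and RelB :: "(('o, 'd) path \<times> ('o, 'd) path) set"
    and X :: "('a, 'e, 'x) action" and F :: "('a, 'e, 'o, ('o, 'd) path) mor"
    and A :: "('a, 'c) cat" and \<iota> :: "'e \<Rightarrow> 'c"
    and X' :: "('a, 'c, 'x) action" and F' :: "('a, 'c, 'o, ('o, 'd) path set) mor"
    and T :: "('a, 'x, ('o, 'd) path) kan_term set"
    and conv :: "('a, 'x, ('o, 'd) path) kan_term \<Rightarrow> ('a, 'x, ('o, 'd) path) kan_term \<Rightarrow> bool"
    and cls :: "('a, 'x, ('o, 'd) path) kan_term \<Rightarrow> ('a, 'x, ('o, 'd) path) kan_term set"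
    and K :: "('o, ('o, 'd) path set, ('a, 'x, ('o, 'd) path) kan_term set) action"
    and \<epsilon> :: "'a \<Rightarrow> 'x \<Rightarrow> ('a, 'x, ('o, 'd) path) kan_term set"
  assumes "wf_digraph \<Gamma>" and "wf_digraph \<Delta>"
    and "P = free_category \<Delta>"
    and "RelB \<subseteq> parallel_pairs P"
    and "B = quotient_category P RelB"
    and "graph_action \<Gamma> X"
    and "graph_morphism \<Gamma> (ugraph P) F"
    and "category A" and "generated_by A \<Gamma> \<iota>"
    and "category_action A X'"
    and "\<forall>A1\<in>verts \<Gamma>. elts X' A1 = elts X A1"
    and "\<forall>a\<in>arcs \<Gamma>. \<forall>x\<in>elts X (tail \<Gamma> a). act X' x (\<iota> a) = act X x a"
    and "is_functor A B F'"
    and "\<forall>A1\<in>verts \<Gamma>. on_obj F' A1 = on_obj F A1"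
    and "\<forall>a\<in>arcs \<Gamma>. on_arr F' (\<iota> a) = arrow_class P RelB (on_arr F a)"
    and "T = kan_terms \<Gamma> P X F"
    and "conv = kan_conv \<Gamma> P RelB X F"
    and "cls = kan_class \<Gamma> P RelB X F"
    and "K = kan_action \<Gamma> P RelB X F"
    and "\<epsilon> = kan_unit \<Gamma> P RelB X F"
  shows
    "((\<forall>t1\<in>T. \<forall>t2\<in>T. conv t1 t2 \<longrightarrow> term_target P t1 = term_target P t2) \<and>
      (\<forall>t\<in>T. class_target P (cls t) = term_target P t)) \<and>
     ((\<forall>t1\<in>T. \<forall>t2\<in>T. \<forall>p1\<in>arr P. \<forall>p2\<in>arr P.
         src P p1 = term_target P t1 \<longrightarrow> src P p2 = term_target P t2 \<longrightarrow>
         cls t1 = cls t2 \<longrightarrow> arrow_class P RelB p1 = arrow_class P RelB p2 \<longrightarrow>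
         cls (term_dot P t1 p1) = cls (term_dot P t2 p2)) \<and>
      (\<forall>t\<in>T. \<forall>p\<in>arr P. src P p = term_target P t \<longrightarrow>
         act K (cls t) (arrow_class P RelB p) = cls (term_dot P t p)) \<and>
      category_action B K) \<and>
     is_kan_extension TYPE('z) A B X' F' K \<epsilon>"
proof -
  have "category P" using assms(2,3) category_free_category by simp
  \<comment> \<open>The locale has its own abbreviations for \<open>B\<close>, \<open>T\<close>,
    \<open>conv\<close>, \<open>cls\<close>, \<open>K\<close> and \<epsilon>; the defining equations
    among the assumptions identify the variables of the statement with them.\<close>
  then interpret kan_presentation_functor \<Gamma> P RelB X F A \<iota> X' F'
    using assms(1,4-15)
    by (intro kan_presentation_functor.intro kan_presentation.intro
        kan_presentation_functor_axioms.intro) simp_all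
  have "\<forall>t1\<in>T. \<forall>t2\<in>T. conv t1 t2 \<longrightarrow> term_target P t1 = term_target P t2"
    using conv_closed(2) assms(16,17) by metis
  moreover have "\<forall>t\<in>T. class_target P (cls t) = term_target P t"
    using class_target_cls assms(16,18) by simp
  \<comment> \<open>By \<open>act_cls\<close> each side is \<open>act K\<close> applied to the class
    of the term and the class of the path, hence depends only on these two classes.\<close>
  moreover have "\<forall>t1\<in>T. \<forall>t2\<in>T. \<forall>p1\<in>arr P. \<forall>p2\<in>arr P.
         src P p1 = term_target P t1 \<longrightarrow> src P p2 = term_target P t2 \<longrightarrow>
         cls t1 = cls t2 \<longrightarrow> arrow_class P RelB p1 = arrow_class P RelB p2 \<longrightarrow>
         cls (term_dot P t1 p1) = cls (term_dot P t2 p2)"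
    using act_cls assms(16,18) by metis
  moreover have "\<forall>t\<in>T. \<forall>p\<in>arr P. src P p = term_target P t \<longrightarrow>
         act K (cls t) (arrow_class P RelB p) = cls (term_dot P t p)"
    using act_cls assms(16,18,19) by simp
  moreover have "category_action B K"
    using category_action_K assms(5,19) by simp
  moreover have "is_kan_extension TYPE('z) A B X' F' K \<epsilon>"
    using is_kan_extension_K assms(5,19,20) by simp
  ultimately show ?thesis by blast
qed

end
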